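(* For every integer $n>1$, $$\zeta(n)=\frac{1}{n!}\lim_{z\to 0^+}\frac{\mathrm d^n}{\mathrm d z^n}\prod_{j=0}^{n-1}\Gamma\left(1-z\,e(j/n)\right).$$
   Context: $\zeta$ is the Riemann zeta function, $\Gamma$ is Euler's gamma function, and $e(x):=e^{2\pi i x}$. *)

theory Defs
  imports "HOL-Complex_Analysis.Complex_Analysis"
begin

text \<open>The Dirichlet series converges, and defines the Riemann zeta function, for
  \<open>Re s > 1\<close>; no meaning is attached to the value for \<open>Re s \<le> 1\<close>.\<close>
definition zeta :: "complex \<Rightarrow> complex" where
  "zeta s = (\<Sum>k. 1 / of_nat (Suc k) powr s)"

definition e :: "real \<Rightarrow> complex" where
  "e x = exp (2 * of_real pi * \<i> * of_real x)"

definition gamma_prod :: "nat \<Rightarrow> complex \<Rightarrow> complex" where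
  "gamma_prod n z = (\<Prod>j<n. Gamma (1 - z * e (real j / real n)))"

text \<open>On the open unit disc no factor meets a pole of \<open>Gamma\<close>, so the iterated \<open>deriv\<close> of
  this product is a genuine derivative there.\<close>
lemma gamma_prod_holomorphic: "gamma_prod n holomorphic_on ball 0 1"
proof -
  have "1 - z * e x \<notin> \<int>\<^sub>\<le>\<^sub>0" if "z \<in> ball 0 1" for z x
  proof
    assume "1 - z * e x \<in> \<int>\<^sub>\<le>\<^sub>0"
    then obtain m where "1 - z * e x = of_int m" "m \<le> 0"
      by (rule nonpos_Ints_cases)
    then have "Re (1 - z * e x) \<le> 0"
      by (simp del: minus_complex.simps)
    moreover have "norm (z * e x) < 1"
      using that by (simp add: e_def norm_mult)
    moreover have "Re (z * e x) \<le> norm (z * e x)"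
      by (rule complex_Re_le_cmod)
    ultimately show False by simp
  qed
  then have "(\<lambda>z. \<Prod>j<n. Gamma (1 - z * e (real j / real n))) holomorphic_on ball 0 1"
    by (intro holomorphic_intros) auto
  then show ?thesis
    by (simp add: gamma_prod_def[abs_def])
qed

end

theory Submission
  imports Defs
begin

text \<open>Write \<open>F\<close> for the product of Gamma factors.  Since \<open>Gamma' = Gamma * Digamma\<close>, on the
  unit disc \<open>F' = F * S\<close> with \<open>S z = (\<Sum>j<n. - e (j/n) * Digamma (1 - z * e (j/n)))\<close>
  (\<open>has_field_derivative_gamma_prod\<close>).  The \<open>m\<close>-th derivative of \<open>S\<close> at \<open>0\<close> is
  \<open>Polygamma m 1\<close> times the power sum \<open>\<Sum>j<n. (- e (j/n)) ^ (m + 1)\<close> over the \<open>n\<close>-th roots of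
  unity (\<open>higher_deriv_gamma_prod_logderiv\<close>).  This power sum vanishes for \<open>m + 1 < n\<close>; for
  \<open>m + 1 = n\<close> it equals \<open>(-1) ^ n * n\<close>, and the series \<open>Polygamma_LIMSEQ\<close> for
  \<open>Polygamma (n - 1) 1\<close> makes the derivative equal to \<open>n! * zeta n\<close>.  So when the Leibniz rule
  is applied to the \<open>(n - 1)\<close>-st derivative of \<open>F * S\<close> at \<open>0\<close>, only the term in which \<open>S\<close>
  takes all the derivatives survives, and the \<open>n\<close>-th derivative of \<open>F\<close> at \<open>0\<close> is
  \<open>F 0 * n! * zeta n = n! * zeta n\<close>.  As \<open>F\<close> is holomorphic around \<open>0\<close>, its \<open>n\<close>-th derivative
  is continuous there, and the limit is its value at \<open>0\<close>.\<close>

lemma norm_e [simp]: "norm (e x) = 1"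
  by (simp add: e_def)

lemma one_minus_mult_e_notin_nonpos_Ints:
  assumes "norm z < 1"
  shows "1 - z * e x \<notin> \<int>\<^sub>\<le>\<^sub>0"
proof
  assume "1 - z * e x \<in> \<int>\<^sub>\<le>\<^sub>0"
  then obtain m where m: "1 - z * e x = of_int m" "m \<le> 0"
    by (rule nonpos_Ints_cases)
  have "Re (z * e x) \<le> norm (z * e x)"
    by (rule complex_Re_le_cmod)
  also have "\<dots> < 1"
    using assms by (simp add: norm_mult)
  finally have "Re (1 - z * e x) > 0"
    by simp
  with m show False
    by simp
qed

lemma sum_e_power_eq_0:
  assumes "0 < m" "m < n"
  shows "(\<Sum>j<n. e (real j / real n) ^ m) = 0"
proof -
  define w where "w = exp (2 * of_real pi * \<i> * of_nat m / of_nat n :: complex)"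
  have "w \<noteq> 1"
    using assms complex_root_unity_eq_1[of n m] by (auto simp: w_def dest: dvd_imp_le)
  moreover have "w ^ n = 1"
    using assms complex_root_unity[of n m] by (simp add: w_def)
  moreover have "e (real j / real n) ^ m = w ^ j" for j
    by (simp add: e_def w_def mult_ac flip: exp_of_nat_mult)
  ultimately show ?thesis
    by (simp add: geometric_sum)
qed

lemma e_power_eq_1:
  assumes "0 < n"
  shows "e (real j / real n) ^ n = 1"
proof -
  have "e (real j / real n) ^ n = exp (2 * of_real pi * \<i> * of_nat j)"
    using assms by (simp add: e_def mult_ac flip: exp_of_nat_mult)
  also have "\<dots> = 1"
    using complex_root_unity[of 1 j] by simp
  finally show ?thesis .
qed

lemma sum_minus_e_power:
  assumes "0 < m" "m \<le> n"
  shows "(\<Sum>j<n. (- e (real j / real n)) ^ m) = (if m = n then (-1) ^ n * of_nat n else 0)"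
proof -
  have "(\<Sum>j<n. (- e (real j / real n)) ^ m) = (-1) ^ m * (\<Sum>j<n. e (real j / real n) ^ m)"
    by (simp add: power_minus[of "e _"] sum_distrib_left)
  then show ?thesis
    using assms sum_e_power_eq_0[of m n] by (auto simp: e_power_eq_1)
qed

lemma has_field_derivative_prod_logderiv:
  fixes f :: "'i \<Rightarrow> 'a :: real_normed_field \<Rightarrow> 'a"
  assumes "\<And>i. i \<in> I \<Longrightarrow> (f i has_field_derivative f i z * l i) (at z within A)"
  shows "((\<lambda>w. \<Prod>i\<in>I. f i w) has_field_derivative (\<Prod>i\<in>I. f i z) * (\<Sum>i\<in>I. l i)) (at z within A)"
  using assms
proof (induction I rule: infinite_finite_induct)
  case (insert i I)
  then have "((\<lambda>w. f i w * (\<Prod>i\<in>I. f i w)) has_field_derivative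
      (f i z * l i) * (\<Prod>i\<in>I. f i z) + ((\<Prod>i\<in>I. f i z) * (\<Sum>i\<in>I. l i)) * f i z) (at z within A)"
    by (intro DERIV_mult) auto
  with insert.hyps show ?case
    by (simp add: algebra_simps)
qed auto

lemma higher_deriv_sum:
  fixes f :: "'i \<Rightarrow> complex \<Rightarrow> complex"
  assumes "\<And>i. i \<in> I \<Longrightarrow> f i holomorphic_on S" "open S" "z \<in> S"
  shows "(deriv ^^ m) (\<lambda>w. \<Sum>i\<in>I. f i w) z = (\<Sum>i\<in>I. (deriv ^^ m) (f i) z)"
  using assms
proof (induction I rule: infinite_finite_induct)
  case (insert i I)
  then have "(deriv ^^ m) (\<lambda>w. f i w + (\<Sum>i\<in>I. f i w)) z =
      (deriv ^^ m) (f i) z + (deriv ^^ m) (\<lambda>w. \<Sum>i\<in>I. f i w) z"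
    by (intro higher_deriv_add[of _ S]) (auto intro!: holomorphic_intros)
  with insert show ?case
    by simp
qed auto

text \<open>The logarithmic derivative of \<open>gamma_prod n\<close> on the unit disc, where no factor has a
  pole or a zero.\<close>
definition gamma_prod_logderiv :: "nat \<Rightarrow> complex \<Rightarrow> complex" where
  "gamma_prod_logderiv n z =
     (\<Sum>j<n. - e (real j / real n) * Digamma (1 - z * e (real j / real n)))"

lemma has_field_derivative_gamma_prod:
  assumes "norm z < 1"
  shows "(gamma_prod n has_field_derivative gamma_prod n z * gamma_prod_logderiv n z) (at z)"
  unfolding gamma_prod_def[abs_def] gamma_prod_logderiv_def
  by (rule has_field_derivative_prod_logderiv)
     (use one_minus_mult_e_notin_nonpos_Ints[OF assms] in
       \<open>auto intro!: derivative_eq_intros\<close>)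

lemma holomorphic_Digamma_one_minus_mult_e:
  "(\<lambda>z. Digamma (1 - z * e x)) holomorphic_on ball 0 1"
proof -
  have "Digamma \<circ> (\<lambda>z. 1 - z * e x) holomorphic_on ball 0 1"
    by (rule holomorphic_on_compose_gen[where t = "- \<int>\<^sub>\<le>\<^sub>0"])
       (auto intro!: holomorphic_intros simp: one_minus_mult_e_notin_nonpos_Ints)
  then show ?thesis
    by (simp add: o_def)
qed

lemma holomorphic_gamma_prod_logderiv: "gamma_prod_logderiv n holomorphic_on ball 0 1"
  unfolding gamma_prod_logderiv_def[abs_def]
  by (intro holomorphic_intros holomorphic_Digamma_one_minus_mult_e)

lemma higher_deriv_Digamma_one_minus_mult_e:
  "(deriv ^^ m) (\<lambda>z. Digamma (1 - z * e x)) 0 = (- e x) ^ m * Polygamma m 1"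
proof -
  have "(deriv ^^ m) (\<lambda>z. Digamma (- e x * z + 1)) 0 =
      (- e x) ^ m * (deriv ^^ m) Digamma (- e x * 0 + 1)"
  proof (rule higher_deriv_compose_linear'[where S = "ball 0 1" and T = "- \<int>\<^sub>\<le>\<^sub>0"])
    fix w :: complex
    assume "w \<in> ball 0 1"
    then show "- e x * w + 1 \<in> - \<int>\<^sub>\<le>\<^sub>0"
      using one_minus_mult_e_notin_nonpos_Ints[of w x] by (simp add: mult_ac)
  qed (auto intro!: holomorphic_intros)
  then show ?thesis
    by (simp add: higher_deriv_Polygamma mult_ac)
qed

lemma higher_deriv_gamma_prod_logderiv:
  "(deriv ^^ m) (gamma_prod_logderiv n) 0 =
     Polygamma m 1 * (\<Sum>j<n. (- e (real j / real n)) ^ Suc m)"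
proof -
  have "(deriv ^^ m) (gamma_prod_logderiv n) 0 =
      (\<Sum>j<n. (deriv ^^ m) (\<lambda>z. - e (real j / real n) * Digamma (1 - z * e (real j / real n))) 0)"
    unfolding gamma_prod_logderiv_def[abs_def]
    by (rule higher_deriv_sum[where S = "ball 0 1"])
       (auto intro!: holomorphic_intros holomorphic_Digamma_one_minus_mult_e
          simp del: mult_minus_left)
  also have "\<dots> = (\<Sum>j<n. - e (real j / real n) * ((- e (real j / real n)) ^ m * Polygamma m 1))"
    by (subst higher_deriv_cmult[where A = "ball 0 1"])
       (auto intro: holomorphic_Digamma_one_minus_mult_e
          simp: higher_deriv_Digamma_one_minus_mult_e)
  finally show ?thesis
    by (simp add: sum_distrib_left mult_ac)
qed

lemma Polygamma_one_eq_zeta: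
  assumes "n > 1"
  shows "(-1) ^ n * Polygamma (n - 1) 1 = fact (n - 1) * zeta (of_nat n)"
proof -
  have "(\<lambda>k. inverse ((1 + of_nat k) ^ n)) sums
      ((-1) ^ n * Polygamma (n - 1) (1 :: complex) / fact (n - 1))"
    using Polygamma_LIMSEQ[of "1 :: complex" "n - 1"] assms by simp
  moreover have "inverse ((1 + of_nat k) ^ n) = 1 / of_nat (Suc k) powr (of_nat n :: complex)" for k
    by (subst powr_nat) (simp add: divide_inverse del: of_nat_Suc flip: of_nat_Suc)
  ultimately have "zeta (of_nat n) = (-1) ^ n * Polygamma (n - 1) 1 / fact (n - 1)"
    unfolding zeta_def by (simp add: sums_iff)
  then show ?thesis
    by (simp add: field_simps)
qed

lemma higher_deriv_gamma_prod_at_0: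
  assumes "n > 1"
  shows "(deriv ^^ n) (gamma_prod n) 0 = fact n * zeta (of_nat n)"
proof -
  let ?F = "gamma_prod n" and ?S = "gamma_prod_logderiv n"
  have S_deriv: "(deriv ^^ m) ?S 0 = (if Suc m = n then fact n * zeta (of_nat n) else 0)"
    if "m < n" for m
  proof (cases "Suc m = n")
    case True
    then have "(deriv ^^ m) ?S 0 = of_nat n * ((-1) ^ n * Polygamma (n - 1) 1)"
      using that sum_minus_e_power[of n n]
      by (auto simp: higher_deriv_gamma_prod_logderiv simp del: power_Suc)
    also have "\<dots> = fact n * zeta (of_nat n)"
      using assms fact_reduce[of n, where ?'a = complex]
      by (simp only: Polygamma_one_eq_zeta mult.assoc)
    finally show ?thesis
      using True by simp
  qed (use that sum_minus_e_power[of "Suc m" n] in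
       \<open>simp add: higher_deriv_gamma_prod_logderiv del: power_Suc\<close>)
  \<comment> \<open>Trading one derivative of \<open>?F\<close> for a factor \<open>?S\<close> makes the Leibniz rule applicable.\<close>
  have "(deriv ^^ n) ?F 0 = (deriv ^^ (n - 1)) (deriv ?F) 0"
    using assms by (cases n) (simp_all add: funpow_swap1)
  also have "\<dots> = (deriv ^^ (n - 1)) (\<lambda>z. ?F z * ?S z) 0"
    by (rule higher_deriv_transform_within_open[where S = "ball 0 1"])
       (auto intro!: holomorphic_intros gamma_prod_holomorphic holomorphic_gamma_prod_logderiv
          DERIV_imp_deriv has_field_derivative_gamma_prod)
  also have "\<dots> = (\<Sum>i = 0..n - 1. of_nat ((n - 1) choose i) *
      (deriv ^^ i) ?F 0 * (deriv ^^ (n - 1 - i)) ?S 0)"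
    by (rule higher_deriv_mult[OF gamma_prod_holomorphic holomorphic_gamma_prod_logderiv]) auto
  \<comment> \<open>For \<open>i > 0\<close> the order \<open>n - 1 - i\<close> of the derivative of \<open>?S\<close> is less than \<open>n - 1\<close>.\<close>
  also have "\<dots> = (\<Sum>i = 0..n - 1. if i = 0 then ?F 0 * (fact n * zeta (of_nat n)) else 0)"
    using assms by (intro sum.cong) (auto simp: S_deriv)
  also have "\<dots> = fact n * zeta (of_nat n)"
    by (simp add: gamma_prod_def)
  finally show ?thesis .
qed

theorem theorem2:
  fixes n :: nat
  assumes "n > 1"
  shows "\<exists>L. ((\<lambda>z. (deriv ^^ n) (gamma_prod n) (complex_of_real z)) \<longlongrightarrow> L) (at_right 0)
             \<and> zeta (of_nat n) = 1 / fact n * L"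
proof (intro exI conjI)
  have "(deriv ^^ n) (gamma_prod n) holomorphic_on ball 0 1"
    by (intro holomorphic_higher_deriv gamma_prod_holomorphic open_ball)
  then have "isCont ((deriv ^^ n) (gamma_prod n)) 0"
    by (metis holomorphic_on_imp_continuous_on continuous_on_eq_continuous_at open_ball
        centre_in_ball zero_less_one)
  then show "((\<lambda>z. (deriv ^^ n) (gamma_prod n) (complex_of_real z)) \<longlongrightarrow>
      (deriv ^^ n) (gamma_prod n) 0) (at_right 0)"
    by (rule isCont_tendsto_compose) (auto intro!: tendsto_eq_intros)
  show "zeta (of_nat n) = 1 / fact n * (deriv ^^ n) (gamma_prod n) 0"
    using assms by (simp add: higher_deriv_gamma_prod_at_0)
qed

end
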